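(* Let $L=L(T)$, $T>0$, be the generator matrix of an irreducible continuous-time Markov chain on a finite set of states $S$, $|S|=n$, whose nonzero off-diagonal entries are $L_{ij}=a_{ij}\exp(-U_{ij}/T)$, with constants $a_{ij}>0$ and $U_{ij}>0$ independent of $T$. Let $G(S,A,U)$ be the weighted directed graph with an arc $(i\rightarrow j)$ of weight $U_{ij}$ for each ordered pair $i\neq j$ with $L_{ij}\neq 0$. Assume that for every $1\le k\le n$ the optimal W-graph $g^{\ast}_k$ with $k$ sinks for $G(S,A,U)$ is unique. Then, for all sufficiently small $T$, all eigenvalues of $L$ are real and distinct; and, writing them as $0,-\lambda_1,\ldots,-\lambda_{n-1}$ with $0<\lambda_1<\lambda_2<\cdots<\lambda_{n-1}$, for every $1\le k\le n-1$, $$\lambda_k = A_k e^{-\Delta_k/T}(1+o(1))\quad\text{as } T\rightarrow 0^+,$$ where $$\Delta_k = \sum_{(i\rightarrow j)\in g^{\ast}_k} U_{ij} - \sum_{(i\rightarrow j)\in g^{\ast}_{k+1}} U_{ij},\qquad A_k = \frac{\prod_{(i\rightarrow j)\in g^{\ast}_k}a_{ij}}{\prod_{(i\rightarrow j)\in g^{\ast}_{k+1}}a_{ij}}.$$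
   Context: The generator matrix $L$ has nonnegative off-diagonal entries $L_{ij}$ (transition rates from state $i$ to state $j$) and diagonal entries $L_{ii}=-\sum_{j\ne i}L_{ij}$, so that its row sums are zero. Irreducible means every state can be reached from every other state along arcs $(i\rightarrow j)$ with $L_{ij}>0$. The set of pairs $(i,j)$ with $L_{ij}\neq 0$ does not depend on $T$. A W-graph with $k$ sinks for a directed weighted graph $G(S,A,U)$ with $n$ vertices is a subgraph of $G$ with vertex set $S$ obtained as follows: select a set of $k$ vertices, called sinks; choose a subset of $n-k$ arcs of $A$ so that there is exactly one outgoing arc from every non-sink vertex (and none from the sinks), and the resulting graph has no (directed) cycles. In particular, the W-graph with $n$ sinks has no arcs (empty sums are $0$ and empty products are $1$). Let $G_k$ denote the set of all W-graphs with $k$ sinks. An optimal W-graph with $k$ sinks is a minimizer $$g^{\ast}_k = \arg\min_{g\in G_k}\sum_{(i\rightarrow j)\in g}U_{ij},\qquad 1\le k\le n.$$ *)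

theory Defs
  imports "HOL-Library.Landau_Symbols" "Jordan_Normal_Form.Spectral_Radius"
begin

text \<open>A chain on \<open>n\<close> states is represented on the state set \<open>{0..<n}\<close>, the index set of an
  \<open>n \<times> n\<close> matrix.\<close>

definition generator_matrix :: "nat \<Rightarrow> real mat \<Rightarrow> bool" where
  "generator_matrix n M \<longleftrightarrow>
     M \<in> carrier_mat n n \<and>
     (\<forall>i<n. \<forall>j<n. i \<noteq> j \<longrightarrow> 0 \<le> M $$ (i, j)) \<and>
     (\<forall>i<n. M $$ (i, i) = - (\<Sum>j\<in>{0..<n} - {i}. M $$ (i, j)))"

definition irreducible_generator :: "nat \<Rightarrow> real mat \<Rightarrow> bool" where
  "irreducible_generator n M \<longleftrightarrow>
     (\<forall>i<n. \<forall>j<n. (i, j) \<in> {(p, q). p < n \<and> q < n \<and> p \<noteq> q \<and> 0 < M $$ (p, q)}\<^sup>*)"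

definition arc_set :: "nat \<Rightarrow> real mat \<Rightarrow> (nat \<times> nat) set" where
  "arc_set n M = {(i, j). i < n \<and> j < n \<and> i \<noteq> j \<and> M $$ (i, j) \<noteq> 0}"

text \<open>A W-graph has the full vertex set \<open>S\<close>, so it is identified with its set of arcs;
  \<open>R\<close> is the set of sinks.\<close>

definition W_graphs :: "'v set \<Rightarrow> ('v \<times> 'v) set \<Rightarrow> nat \<Rightarrow> ('v \<times> 'v) set set" where
  "W_graphs S A k = {g. g \<subseteq> A \<and> acyclic g \<and>
     (\<exists>R \<subseteq> S. card R = k \<and> card g = card S - k \<and>
        (\<forall>i\<in>S - R. \<exists>!j. (i, j) \<in> g) \<and> (\<forall>i\<in>R. \<forall>j. (i, j) \<notin> g))}"

definition W_weight :: "('v \<Rightarrow> 'v \<Rightarrow> real) \<Rightarrow> ('v \<times> 'v) set \<Rightarrow> real" where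
  "W_weight U g = (\<Sum>(i, j)\<in>g. U i j)"

definition unique_opt_W ::
    "'v set \<Rightarrow> ('v \<times> 'v) set \<Rightarrow> ('v \<Rightarrow> 'v \<Rightarrow> real) \<Rightarrow> nat \<Rightarrow> bool" where
  "unique_opt_W S A U k \<longleftrightarrow> (\<exists>!g. is_arg_min (W_weight U) (\<lambda>h. h \<in> W_graphs S A k) g)"

definition opt_W ::
    "'v set \<Rightarrow> ('v \<times> 'v) set \<Rightarrow> ('v \<Rightarrow> 'v \<Rightarrow> real) \<Rightarrow> nat \<Rightarrow> ('v \<times> 'v) set" where
  "opt_W S A U k = arg_min_on (W_weight U) (W_graphs S A k)"

definition W_exponent ::
    "'v set \<Rightarrow> ('v \<times> 'v) set \<Rightarrow> ('v \<Rightarrow> 'v \<Rightarrow> real) \<Rightarrow> nat \<Rightarrow> real" where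
  "W_exponent S A U k =
     (\<Sum>(i, j)\<in>opt_W S A U k. U i j) - (\<Sum>(i, j)\<in>opt_W S A U (k + 1). U i j)"

definition W_prefactor ::
    "'v set \<Rightarrow> ('v \<times> 'v) set \<Rightarrow> ('v \<Rightarrow> 'v \<Rightarrow> real) \<Rightarrow> ('v \<Rightarrow> 'v \<Rightarrow> real) \<Rightarrow> nat \<Rightarrow> real" where
  "W_prefactor S A U a k =
     (\<Prod>(i, j)\<in>opt_W S A U k. a i j) / (\<Prod>(i, j)\<in>opt_W S A U (k + 1). a i j)"

abbreviation complex_mat :: "real mat \<Rightarrow> complex mat" where
  "complex_mat M \<equiv> map_mat complex_of_real M"

end

theory Submission
  imports Defs
begin

text \<open>By the matrix forest theorem, \<open>det (t I - L)\<close> is the sum over all W-graphs of \<open>t\<close> to the number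
  of sinks times the product of the rates along the arcs, so for small \<open>T\<close> its coefficients are
  governed by the optimal W-graphs. An exchange argument shows that the optimal weight is a strictly
  convex function of the number of sinks. Hence, for \<open>t\<close> of the order of \<open>exp (- \<Delta>\<^sub>k / T)\<close>, only the
  W-graphs \<open>g\<^sup>*\<^sub>k\<close> and \<open>g\<^sup>*\<^sub>k\<^sub>+\<^sub>1\<close> contribute in the limit, and they produce a sign change close to
  \<open>- A\<^sub>k exp (- \<Delta>\<^sub>k / T)\<close>. These \<open>n - 1\<close> distinct roots together with \<open>0\<close> exhaust the spectrum.\<close>

section \<open>W-graphs\<close>

text \<open>W-graphs with all numbers of sinks at once: the sinks need not be named, since they are
  the vertices outside \<open>Domain g\<close>, and their number can be read off from
  \<open>card g\<close>.\<close>

definition forests :: "('v \<times> 'v) set \<Rightarrow> ('v \<times> 'v) set set" where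
  "forests A = {g. g \<subseteq> A \<and> acyclic g \<and> single_valued g}"

lemma card_Domain_single_valued:
  assumes "single_valued g"
  shows "card (Domain g) = card g"
proof -
  have "inj_on fst g"
    using assms by (auto simp: inj_on_def single_valued_def)
  then show ?thesis
    by (metis card_image fst_eq_Domain)
qed

lemma finite_forest:
  assumes "finite S" "A \<subseteq> S \<times> S" "g \<in> forests A"
  shows "finite g"
proof -
  have "g \<subseteq> S \<times> S"
    using assms(2,3) by (auto simp: forests_def)
  then show ?thesis
    using assms(1) by (meson finite_SigmaI finite_subset)
qed

lemma finite_forests:
  assumes "finite S" "A \<subseteq> S \<times> S"
  shows "finite (forests A)"
proof -
  have "finite A"
    using assms by (meson finite_SigmaI finite_subset)
  then show ?thesis
    by (intro finite_subset[of "forests A" "Pow A"]) (auto simp: forests_def)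
qed

text \<open>The sink set is forced to be \<open>S - Domain g\<close>. The additive form
  \<open>card g + k = card S\<close> avoids truncated subtraction; it is justified because the sinks
  lie in \<open>S\<close>, so \<open>k\<close> is at most \<open>card S\<close>.\<close>

lemma W_graphs_eq_forests:
  assumes S: "finite S" and A: "A \<subseteq> S \<times> S"
  shows "W_graphs S A k = {g \<in> forests A. card g + k = card S}"
proof (intro equalityI subsetI)
  fix g assume "g \<in> W_graphs S A k"
  then have "g \<subseteq> A \<and> acyclic g \<and> (\<exists>R \<subseteq> S. card R = k \<and> card g = card S - k \<and>
    (\<forall>i\<in>S - R. \<exists>!j. (i, j) \<in> g) \<and> (\<forall>i\<in>R. \<forall>j. (i, j) \<notin> g))"
    by (simp only: W_graphs_def mem_Collect_eq)
  then obtain R where g: "g \<subseteq> A" "acyclic g" and R: "R \<subseteq> S" "card R = k" "card g = card S - k"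
    and out: "\<forall>i\<in>S - R. \<exists>!j. (i, j) \<in> g" and sink: "\<forall>i\<in>R. \<forall>j. (i, j) \<notin> g"
    by (elim conjE exE)
  have "single_valued g"
  proof (rule single_valuedI)
    fix i j l assume ij: "(i, j) \<in> g" "(i, l) \<in> g"
    then have "i \<in> S" "i \<notin> R"
      using g(1) A sink by auto
    then show "j = l"
      using ij bspec[OF out, of i] by (simp add: Ex1_def) metis
  qed
  moreover have "k \<le> card S"
    using R(2) card_mono[OF S R(1)] by simp
  ultimately show "g \<in> {g \<in> forests A. card g + k = card S}"
    using g R by (simp add: forests_def)
next
  fix g assume "g \<in> {g \<in> forests A. card g + k = card S}"
  then have g: "g \<subseteq> A" "acyclic g" "single_valued g" and k: "card g + k = card S"
    by (auto simp: forests_def)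
  have D: "Domain g \<subseteq> S"
    using subset_trans[OF g(1) A] by auto
  have "card (S - Domain g) = k"
    using card_Diff_subset[OF finite_subset[OF D S] D] k card_Domain_single_valued[OF g(3)] by simp
  moreover have "\<exists>!j. (i, j) \<in> g" if "i \<in> S - (S - Domain g)" for i
    using that g(3) by (auto dest: single_valuedD)
  moreover have "\<forall>i\<in>S - Domain g. \<forall>j. (i, j) \<notin> g"
    by auto
  ultimately show "g \<in> W_graphs S A k"
    unfolding W_graphs_def using g(1,2) k
    by (intro CollectI conjI exI[of _ "S - Domain g"]) auto
qed

text \<open>Following arcs in a finite acyclic graph must end somewhere, so every forest has at
  least one sink.\<close>

lemma card_forest_less:
  assumes S: "finite S" "S \<noteq> {}" and A: "A \<subseteq> S \<times> S" and g: "g \<in> forests A"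
  shows "card g < card S"
proof -
  have "wf (g\<inverse>)"
    using g finite_forest[OF S(1) A g] by (auto simp: forests_def intro: finite_acyclic_wf_converse)
  then obtain z where z: "z \<in> S" "\<And>y. (y, z) \<in> g\<inverse> \<Longrightarrow> y \<notin> S"
    using S(2) by (meson ex_in_conv wfE_min)
  have "g \<subseteq> S \<times> S"
    using g A by (auto simp: forests_def)
  then have "z \<notin> Domain g" "Domain g \<subseteq> S"
    using z by blast+
  then have "Domain g \<subset> S"
    using z(1) by blast
  then have "card (Domain g) < card S"
    using S(1) psubset_card_mono by blast
  then show ?thesis
    using g by (simp add: forests_def card_Domain_single_valued)
qed

section \<open>Trees of a forest and exchange of arcs between two forests\<close>

lemma rtrancl_to_sink_unique:
  assumes "single_valued g" "(i, r) \<in> g\<^sup>*" "(i, s) \<in> g\<^sup>*" "r \<notin> Domain g" "s \<notin> Domain g"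
  shows "r = s"
  using single_valued_confluent[OF assms(1-3)] assms(4,5)
  by (auto simp: Not_Domain_rtrancl)

lemma rtrancl_to_sink_step:
  assumes "single_valued g" "r \<notin> Domain g" "(i, r) \<in> g\<^sup>*" "(i, j) \<in> g"
  shows "(j, r) \<in> g\<^sup>*"
  using assms(3)
proof (cases rule: converse_rtranclE)
  case base
  then show ?thesis using assms(2,4) by blast
next
  case (step y)
  then show ?thesis using single_valuedD[OF assms(1,4), of y] by simp
qed

text \<open>A walk that has entered \<open>D\<close> uses only arcs of \<open>x\<close> and can
  never leave again. A cycle would thus lie entirely in one of the two acyclic parts.\<close>

lemma acyclic_glue:
  assumes "finite x" "finite y" "acyclic x" "acyclic y" "D \<inter> E = {}"
    and "\<And>i j. (i, j) \<in> x \<Longrightarrow> i \<in> D \<Longrightarrow> j \<in> D"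
  shows "acyclic ({e \<in> x. fst e \<in> D} \<union> {e \<in> y. fst e \<in> E})"
proof -
  let ?x = "{e \<in> x. fst e \<in> D}" and ?y = "{e \<in> y. fst e \<in> E}"
  have "acyclic ?x" "acyclic ?y"
    using assms(3,4) by (auto elim: acyclic_subset)
  then have "wf (?x\<inverse>)" "wf (?y\<inverse>)"
    using assms(1,2) by (auto intro: finite_acyclic_wf_converse)
  moreover have "Domain (?x\<inverse>) \<inter> Range (?y\<inverse>) = {}"
    using assms(5,6) by fastforce
  ultimately have "wf (?x\<inverse> \<union> ?y\<inverse>)"
    by (rule wf_Un)
  then have "acyclic ((?x \<union> ?y)\<inverse>)"
    by (simp add: converse_Un wf_acyclic)
  then show ?thesis
    by (simp only: acyclic_converse)
qed

text \<open>Exchange property: \<open>h\<close> has more sinks than \<open>g\<close>, so some tree of \<open>h\<close> contains no sink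
  of \<open>g\<close>. Swapping the arcs of \<open>g\<close> and \<open>h\<close> that leave the vertices of this tree creates no cycle,
  because no arc of \<open>h\<close> enters or leaves the tree.\<close>

lemma forest_exchange:
  assumes S: "finite S" and A: "A \<subseteq> S \<times> S" and g: "g \<in> forests A" and h: "h \<in> forests A"
    and less: "card h < card g"
  obtains g' h' where "g' \<in> forests A" "h' \<in> forests A"
    "card g = Suc (card g')" "card h' = Suc (card h)" "g' \<union> h' = g \<union> h" "g' \<inter> h' = g \<inter> h"
proof -
  have gA: "g \<subseteq> A" "acyclic g" "single_valued g" and hA: "h \<subseteq> A" "acyclic h" "single_valued h"
    using g h by (auto simp: forests_def)
  have fin: "finite g" "finite h"
    using finite_forest[OF S A] g h by auto
  have dom: "Domain g \<subseteq> S" "Domain h \<subseteq> S"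
    using gA hA A by auto
  have cards: "card (S - Domain g) < card (S - Domain h)"
    using less dom S card_mono[OF S dom(1)]
    by (simp add: card_Diff_subset finite_subset[OF _ S] card_Domain_single_valued gA hA)
  \<comment> \<open>Pigeonhole: otherwise each sink of \<open>h\<close> is reached in
    \<open>h\<close> from some sink of \<open>g\<close>. This choice is injective, since a vertex
    reaches only one sink of \<open>h\<close>, but \<open>h\<close> has more sinks than
    \<open>g\<close>.\<close>
  have "\<exists>r \<in> S - Domain h. \<forall>i \<in> S - Domain g. (i, r) \<notin> h\<^sup>*"
  proof (rule ccontr)
    assume "\<not> ?thesis"
    then obtain c where c: "\<And>r. r \<in> S - Domain h \<Longrightarrow> c r \<in> S - Domain g \<and> (c r, r) \<in> h\<^sup>*"
      by metis
    have "inj_on c (S - Domain h)"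
      using c rtrancl_to_sink_unique[OF hA(3)] by (metis DiffD2 inj_onI)
    then have "card (S - Domain h) \<le> card (S - Domain g)"
      using c S by (intro card_inj_on_le) auto
    then show False
      using cards by simp
  qed
  then obtain r where r: "r \<in> S" "r \<notin> Domain h" and free: "\<And>i. i \<in> S \<Longrightarrow> (i, r) \<in> h\<^sup>* \<Longrightarrow> i \<in> Domain g"
    by blast
  \<comment> \<open>The vertices of the tree of \<open>h\<close> with root \<open>r\<close>; neither
    \<open>D\<close> nor its complement is left by an arc of \<open>h\<close>.\<close>
  define D where "D = {i. (i, r) \<in> h\<^sup>*}"
  have closed: "j \<in> D" if "(i, j) \<in> h" "i \<in> D" for i j
    using that rtrancl_to_sink_step[OF hA(3) r(2)] by (simp add: D_def)
  have closed': "j \<in> - D" if "(i, j) \<in> h" "i \<in> - D" for i j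
    using that by (auto simp: D_def intro: converse_rtrancl_into_rtrancl)
  have DS: "D \<subseteq> S"
  proof
    fix i assume "i \<in> D"
    then show "i \<in> S"
      using r(1) dom(2) unfolding D_def by (auto elim!: converse_rtranclE[of i])
  qed
  have Dg: "D \<subseteq> Domain g"
    using DS free by (auto simp: D_def)
  have Dh: "D - {r} \<subseteq> Domain h"
    by (auto simp: D_def elim: converse_rtranclE)
  have rD: "r \<in> D"
    by (simp add: D_def)
  define gi go hi ho where
    "gi = {e \<in> g. fst e \<in> D}" and "go = {e \<in> g. fst e \<in> - D}" and
    "hi = {e \<in> h. fst e \<in> D}" and "ho = {e \<in> h. fst e \<in> - D}"
  note parts = gi_def go_def hi_def ho_def
  have g_split: "g = gi \<union> go" "gi \<inter> go = {}" and h_split: "h = hi \<union> ho" "hi \<inter> ho = {}"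
    by (auto simp: parts)
  have fins: "finite gi" "finite go" "finite hi" "finite ho"
    using fin by (auto simp: parts)
  have disj: "hi \<inter> go = {}" "gi \<inter> ho = {}"
    by (auto simp: parts)
  have sv: "single_valued gi" "single_valued hi"
    using gA(3) hA(3) by (auto simp: parts single_valued_def)
  have "Domain gi = D" "Domain hi = D - {r}"
    using Dg Dh r(2) unfolding parts by fastforce+
  then have "card gi = card D" "card hi = card (D - {r})"
    using sv[THEN card_Domain_single_valued] by simp_all
  \<comment> \<open>Inside \<open>D\<close> every vertex has an arc of \<open>g\<close>, while
    exactly the root \<open>r\<close> has no arc of \<open>h\<close>, so the swap moves one arc from
    one forest to the other.\<close>
  then have card: "card gi = Suc (card hi)"
    using card_Suc_Diff1[OF finite_subset[OF DS S] rD] by simp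
  have "acyclic (hi \<union> go)"
    unfolding parts by (rule acyclic_glue) (use fin gA hA closed in auto)
  \<comment> \<open>The closed side is now the complement of \<open>D\<close>, again for
    \<open>h\<close>; the union is commuted so that the part of \<open>h\<close> comes
    first.\<close>
  moreover have "acyclic (gi \<union> ho)"
    unfolding parts Un_commute[of "{e \<in> g. fst e \<in> D}"]
    by (rule acyclic_glue) (use fin gA hA closed' in auto)
  moreover have "single_valued (hi \<union> go)" "single_valued (gi \<union> ho)"
    using gA(3) hA(3) by (auto simp: parts single_valued_def)
  ultimately have "hi \<union> go \<in> forests A" "gi \<union> ho \<in> forests A"
    using gA(1) hA(1) by (auto simp: forests_def parts)
  moreover have "card g = Suc (card (hi \<union> go))" "card (gi \<union> ho) = Suc (card h)"
    using g_split h_split disj fins card by (auto simp: card_Un_disjoint)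
  moreover have "(hi \<union> go) \<union> (gi \<union> ho) = g \<union> h" "(hi \<union> go) \<inter> (gi \<union> ho) = g \<inter> h"
    by (auto simp: parts)
  ultimately show thesis
    by (rule that)
qed

section \<open>Matrix forest theorem\<close>

text \<open>With one outgoing arc per vertex, a walk that starts on a cycle stays on it. Hence a
  vertex on a cycle never reaches a sink.\<close>

lemma rtrancl_from_cycle:
  assumes sv: "single_valued g" and x: "(x, x) \<in> g\<^sup>+" and y: "(x, y) \<in> g\<^sup>*"
  shows "(y, x) \<in> g\<^sup>+"
  using y
proof (induction rule: rtrancl_induct)
  case base
  show ?case by (rule x)
next
  case (step y z)
  from step.IH obtain w where "(y, w) \<in> g" "(w, x) \<in> g\<^sup>*"
    by (auto dest: tranclD)
  moreover have "w = z"
    using \<open>(y, w) \<in> g\<close> step.hyps(2) sv by (auto dest: single_valuedD)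
  ultimately show ?case
    using x by (auto intro: rtrancl_trancl_trancl)
qed

definition fun_arcs :: "nat \<Rightarrow> (nat \<Rightarrow> nat) \<Rightarrow> (nat \<times> nat) set" where
  "fun_arcs n f = {(i, f i) | i. i < n \<and> f i \<noteq> i}"

text \<open>The row \<open>e\<^sub>i - e\<^sub>j\<close> of an arc. The test \<open>l = i\<close>
  comes first, so that for \<open>j = i\<close> the row is \<open>e\<^sub>i\<close>, which is the
  row of a sink.\<close>

definition arc_vec :: "nat \<Rightarrow> nat \<Rightarrow> nat \<Rightarrow> 'a :: comm_ring_1 vec" where
  "arc_vec n i j = vec n (\<lambda>l. if l = i then 1 else if l = j then - 1 else 0)"

text \<open>Without cycles only the identity permutation contributes to the Leibniz sum, and it
  contributes 1. With a cycle, the indicator of the vertices that never reach a sink lies in the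
  kernel.\<close>

lemma det_functional_graph:
  fixes f :: "nat \<Rightarrow> nat"
  assumes f: "\<And>i. i < n \<Longrightarrow> f i < n"
  shows "det (mat\<^sub>r n n (\<lambda>i. arc_vec n i (f i)) :: 'a :: idom mat) = (if acyclic (fun_arcs n f) then 1 else 0)"
proof -
  let ?M = "mat\<^sub>r n n (\<lambda>i. arc_vec n i (f i)) :: 'a mat" and ?g = "fun_arcs n f"
  have M: "?M \<in> carrier_mat n n"
    by simp
  have fin: "finite ?g"
    by (rule finite_subset[of _ "(\<lambda>i. (i, f i)) ` {..<n}"]) (auto simp: fun_arcs_def)
  have entry: "?M $$ (i, j) = (if j = i then 1 else if j = f i then - 1 else 0)" if "i < n" "j < n" for i j
    using that by (simp add: arc_vec_def)
  show ?thesis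
  proof (cases "acyclic ?g")
    case True
    have "(\<Prod>i = 0..<n. ?M $$ (i, p i)) = 0" if p: "p permutes {0..<n}" and "p \<noteq> id" for p
    proof (rule ccontr)
      assume nz: "(\<Prod>i = 0..<n. ?M $$ (i, p i)) \<noteq> 0"
      \<comment> \<open>A nonzero product forces the permutation to move points only along
        arcs.\<close>
      have pf: "p i = f i" if "p i \<noteq> i" for i
      proof -
        have "i < n"
          using p that by (metis atLeastLessThan_iff less_eq_nat.simps(1) permutes_def)
        moreover from this have "p i < n"
          using permutes_in_image[OF p, of i] by simp
        moreover have "?M $$ (i, p i) \<noteq> 0"
          using nz \<open>i < n\<close> by auto
        ultimately show ?thesis
          using entry[of i "p i"] that by (auto split: if_splits)
      qed
      have "wf (?g\<inverse>)"
        using fin True by (rule finite_acyclic_wf_converse)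
      moreover obtain i where "i \<in> {i. p i \<noteq> i}"
        using \<open>p \<noteq> id\<close> by (auto simp: fun_eq_iff)
      \<comment> \<open>A last moved point along the arcs: its image is then fixed by
        \<open>p\<close>, which contradicts injectivity.\<close>
      ultimately obtain z where "z \<in> {i. p i \<noteq> i}" "\<And>y. (y, z) \<in> ?g\<inverse> \<Longrightarrow> y \<notin> {i. p i \<noteq> i}"
        by (rule wfE_min) blast
      then have z: "p z \<noteq> z" "\<And>y. (y, z) \<in> ?g\<inverse> \<Longrightarrow> y \<notin> {i. p i \<noteq> i}"
        by auto
      have "z < n"
        using p z(1) by (metis atLeastLessThan_iff less_eq_nat.simps(1) permutes_def)
      then have "(p z, z) \<in> ?g\<inverse>"
        using pf[OF z(1)] z(1) by (auto simp: fun_arcs_def)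
      then have "p (p z) = p z"
        using z(2) by blast
      then show False
        using z(1) permutes_inj[OF p] by (simp add: inj_eq)
    qed
    then have "det ?M = (\<Sum>p\<in>{id}. signof p * (\<Prod>i = 0..<n. ?M $$ (i, p i)))"
      unfolding det_def'[OF M]
      by (intro sum.mono_neutral_right) (auto simp: finite_permutations permutes_id)
    moreover have "(\<Prod>i = 0..<n. ?M $$ (i, id i)) = 1"
      by (rule prod.neutral) (simp add: arc_vec_def)
    ultimately show ?thesis
      using True by simp
  next
    case False
    have sv: "single_valued ?g"
      by (auto simp: single_valued_def fun_arcs_def)
    from False obtain x where x: "(x, x) \<in> ?g\<^sup>+"
      by (auto simp: acyclic_def)
    have xn: "x < n"
      using tranclD[OF x] by (auto simp: fun_arcs_def)
    \<comment> \<open>Membership in \<open>E\<close> is constant along arcs and holds at sinks. So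
      \<open>v\<close>, the indicator of the complement, is annihilated by every row, and it is
      nonzero at the cycle vertex \<open>x\<close>.\<close>
    define E where "E = {i. \<exists>r. (i, r) \<in> ?g\<^sup>* \<and> r \<notin> Domain ?g}"
    have xE: "x \<notin> E"
      using rtrancl_from_cycle[OF sv x] unfolding E_def by (blast dest: tranclD)
    define v :: "'a vec" where "v = vec n (\<lambda>i. if i \<in> E then 0 else 1)"
    have v: "v \<in> carrier_vec n"
      by (simp add: v_def)
    have "v $ x \<noteq> 0\<^sub>v n $ x"
      using xn xE by (simp add: v_def)
    then have "v \<noteq> 0\<^sub>v n"
      by metis
    moreover have "?M *\<^sub>v v = 0\<^sub>v n"
    proof (rule eq_vecI)
      fix i assume "i < dim_vec (0\<^sub>v n :: 'a vec)"
      then have i: "i < n" by simp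
      have "(?M *\<^sub>v v) $ i = (\<Sum>j = 0..<n. ?M $$ (i, j) * v $ j)"
        using i v by (simp add: scalar_prod_def row_def)
      also have "\<dots> = (\<Sum>j = 0..<n. (if j = i then v $ j else 0) - (if f i \<noteq> i \<and> j = f i then v $ j else 0))"
        by (rule sum.cong) (use i entry in auto)
      also have "\<dots> = v $ i - (if f i \<noteq> i then v $ (f i) else 0)"
        using i f[OF i] by (auto simp: sum_subtractf)
      also have "\<dots> = 0"
      proof (cases "f i = i")
        case True
        then have "i \<notin> Domain ?g"
          by (auto simp: fun_arcs_def)
        then have "i \<in> E"
          by (auto simp: E_def)
        then show ?thesis
          using True i by (simp add: v_def)
      next
        case False
        then have "(i, f i) \<in> ?g"
          using i by (auto simp: fun_arcs_def)
        then have "i \<in> E \<longleftrightarrow> f i \<in> E"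
          unfolding E_def using rtrancl_to_sink_step[OF sv]
          by (blast intro: converse_rtrancl_into_rtrancl)
        then show ?thesis
          using False i f[OF i] by (simp add: v_def)
      qed
      finally show "(?M *\<^sub>v v) $ i = 0\<^sub>v n $ i"
        using i by simp
    qed simp
    ultimately have "det ?M = 0"
      using det_0_iff_vec_prod_zero[OF M] v by blast
    then show ?thesis
      using False by simp
  qed
qed

lemma card_fun_arcs: "card (fun_arcs n f) = card {i \<in> {0..<n}. f i \<noteq> i}"
proof -
  have "fun_arcs n f = (\<lambda>i. (i, f i)) ` {i \<in> {0..<n}. f i \<noteq> i}"
    by (auto simp: fun_arcs_def)
  then show ?thesis
    by (simp add: card_image inj_on_def)
qed

lemma prod_fun_arcs:
  fixes w :: "nat \<Rightarrow> nat \<Rightarrow> 'a :: comm_monoid_mult"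
  shows "(\<Prod>(i, j)\<in>fun_arcs n f. w i j) = (\<Prod>i\<in>{i \<in> {0..<n}. f i \<noteq> i}. w i (f i))"
proof -
  have "fun_arcs n f = (\<lambda>i. (i, f i)) ` {i \<in> {0..<n}. f i \<noteq> i}"
    by (auto simp: fun_arcs_def)
  then show ?thesis
    by (simp add: prod.reindex inj_on_def)
qed

text \<open>Every row of the matrix is \<open>t e\<^sub>i + (\<Sum>j. w\<^sub>i\<^sub>j (e\<^sub>i - e\<^sub>j))\<close>. Multilinearity of the determinant
  turns it into a sum over all maps \<open>f\<close>, where \<open>f i = i\<close> stands for the summand \<open>t e\<^sub>i\<close>, i.e. for a
  sink at \<open>i\<close>.\<close>

theorem matrix_forest:
  fixes w :: "nat \<Rightarrow> nat \<Rightarrow> 'a :: idom"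
  shows "det (mat n n (\<lambda>(i, j). if i = j then t + (\<Sum>l\<in>{0..<n} - {i}. w i l) else - w i j)) =
    (\<Sum>g\<in>forests {(i, j). i < n \<and> j < n \<and> i \<noteq> j}. t ^ (n - card g) * (\<Prod>(i, j)\<in>g. w i j))"
    (is "det ?M = _")
proof -
  define c where "c i j = (if j = i then t else w i j)" for i j
  \<comment> \<open>Pinning the maps to the identity outside the index range makes \<open>F\<close>
    finite and lets a map be recovered from its arcs.\<close>
  define F where "F = {f. (\<forall>i\<in>{0..<n}. f i \<in> {0..<n}) \<and> (\<forall>i. i \<notin> {0..<n} \<longrightarrow> f i = i)}"
  let ?A = "{(i, j). i < n \<and> j < n \<and> i \<noteq> j}"
  let ?a = "\<lambda>i j. c i j \<cdot>\<^sub>v arc_vec n i j"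
  have arc_carrier: "arc_vec n i j \<in> carrier_vec n" for i j
    by (simp add: arc_vec_def)
  have finF: "finite F"
    unfolding F_def by (rule finite_bounded_functions) auto
  have M: "?M = mat\<^sub>r n n (\<lambda>i. finsum_vec TYPE('a) n (?a i) {0..<n})"
  proof (rule eq_matI)
    fix i l
    assume "i < dim_row (mat\<^sub>r n n (\<lambda>i. finsum_vec TYPE('a) n (?a i) {0..<n}))"
      and "l < dim_col (mat\<^sub>r n n (\<lambda>i. finsum_vec TYPE('a) n (?a i) {0..<n}))"
    then have il: "i < n" "l < n" by auto
    have "finsum_vec TYPE('a) n (?a i) {0..<n} $ l = (\<Sum>j = 0..<n. ?a i j $ l)"
      by (rule index_finsum_vec) (use il arc_carrier in auto)
    also have "\<dots> = (\<Sum>j = 0..<n. c i j * (if l = i then 1 else if l = j then - 1 else 0))"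
      using il by (simp add: arc_vec_def)
    also have "\<dots> = (if i = l then t + (\<Sum>l\<in>{0..<n} - {i}. w i l) else - w i l)"
    proof (cases "l = i")
      case True
      have "(\<Sum>j = 0..<n. c i j) = c i i + (\<Sum>j\<in>{0..<n} - {i}. c i j)"
        using il by (simp add: sum.remove)
      then show ?thesis
        using True by (simp add: c_def)
    next
      case False
      then have "(\<Sum>j = 0..<n. c i j * (if l = i then 1 else if l = j then - 1 else 0))
        = (\<Sum>j = 0..<n. if l = j then - c i j else 0)"
        by (intro sum.cong) auto
      then show ?thesis
        using False il by (simp add: c_def)
    qed
    finally show "?M $$ (i, l) = mat\<^sub>r n n (\<lambda>i. finsum_vec TYPE('a) n (?a i) {0..<n}) $$ (i, l)"
      using il by simp
  qed auto
  have prod_c: "(\<Prod>i = 0..<n. c i (f i)) = t ^ (n - card (fun_arcs n f)) * (\<Prod>(i, j)\<in>fun_arcs n f. w i j)" for f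
  proof -
    let ?P = "{i \<in> {0..<n}. f i \<noteq> i}" and ?Q = "{i \<in> {0..<n}. f i = i}"
    have PQ: "{0..<n} = ?Q \<union> ?P" "?Q \<inter> ?P = {}" by auto
    have "card (?Q \<union> ?P) = card ?Q + card ?P"
      by (rule card_Un_disjoint) auto
    then have "card ?Q + card ?P = n"
      unfolding PQ(1)[symmetric] by simp
    then have "card ?Q = n - card (fun_arcs n f)"
      by (simp add: card_fun_arcs)
    moreover have "(\<Prod>i = 0..<n. c i (f i)) = (\<Prod>i\<in>?Q. c i (f i)) * (\<Prod>i\<in>?P. c i (f i))"
      by (subst PQ(1), rule prod.union_disjoint) auto
    moreover have "(\<Prod>i\<in>?Q. c i (f i)) = t ^ card ?Q"
      by (simp add: c_def)
    moreover have "(\<Prod>i\<in>?P. c i (f i)) = (\<Prod>i\<in>?P. w i (f i))"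
      by (simp add: c_def)
    ultimately show ?thesis
      by (simp add: prod_fun_arcs)
  qed
  have "det ?M = (\<Sum>f\<in>F. det (mat\<^sub>r n n (\<lambda>i. ?a i (f i))))"
    unfolding M F_def by (rule det_linear_rows_sum) (use arc_carrier in auto)
  also have "\<dots> = (\<Sum>f\<in>F. (\<Prod>i = 0..<n. c i (f i)) * det (mat\<^sub>r n n (\<lambda>i. arc_vec n i (f i))))"
    by (intro sum.cong refl det_rows_mul) (use arc_carrier in auto)
  also have "\<dots> = (\<Sum>f\<in>F. if acyclic (fun_arcs n f) then \<Prod>i = 0..<n. c i (f i) else 0)"
  proof (rule sum.cong)
    fix f assume "f \<in> F"
    then have "f i < n" if "i < n" for i
      using that by (auto simp: F_def)
    then show "(\<Prod>i = 0..<n. c i (f i)) * det (mat\<^sub>r n n (\<lambda>i. arc_vec n i (f i))) =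
      (if acyclic (fun_arcs n f) then \<Prod>i = 0..<n. c i (f i) else 0)"
      by (simp add: det_functional_graph)
  qed simp
  also have "\<dots> = (\<Sum>f\<in>{f \<in> F. acyclic (fun_arcs n f)}. \<Prod>i = 0..<n. c i (f i))"
    using finF by (simp add: sum.inter_filter)
  also have "\<dots> = (\<Sum>g\<in>forests ?A. t ^ (n - card g) * (\<Prod>(i, j)\<in>g. w i j))"
  \<comment> \<open>The inverse sends a vertex to the head of its unique outgoing arc, and a sink to
    itself.\<close>
  proof (rule sum.reindex_bij_witness[where j = "fun_arcs n"
        and i = "\<lambda>g i. if i \<in> Domain g then THE j. (i, j) \<in> g else i"])
    fix f assume "f \<in> {f \<in> F. acyclic (fun_arcs n f)}"
    then have f: "f \<in> F" "acyclic (fun_arcs n f)" by auto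
    show "(\<lambda>i. if i \<in> Domain (fun_arcs n f) then THE j. (i, j) \<in> fun_arcs n f else i) = f"
      using f(1) by (fastforce simp: fun_arcs_def F_def)
    show "fun_arcs n f \<in> forests ?A"
      using f by (auto simp: forests_def fun_arcs_def F_def single_valued_def)
    show "t ^ (n - card (fun_arcs n f)) * (\<Prod>(i, j)\<in>fun_arcs n f. w i j) = (\<Prod>i = 0..<n. c i (f i))"
      by (simp add: prod_c)
  next
    fix g assume "g \<in> forests ?A"
    then have g: "g \<subseteq> ?A" "acyclic g" "single_valued g"
      by (auto simp: forests_def)
    let ?f = "\<lambda>i. if i \<in> Domain g then THE j. (i, j) \<in> g else i"
    have f: "?f i = j" if "(i, j) \<in> g" for i j
      using that g(3) by (auto simp: single_valued_def)
    have out: "?f i = i" if "i \<notin> Domain g" for i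
      using that by simp
    show arcs: "fun_arcs n ?f = g"
    proof (intro equalityI subrelI)
      fix i j assume "(i, j) \<in> fun_arcs n ?f"
      then have j: "j = ?f i" "?f i \<noteq> i"
        unfolding fun_arcs_def by blast+
      then have "i \<in> Domain g" using out by blast
      then obtain j' where "(i, j') \<in> g" by blast
      then show "(i, j) \<in> g"
        using f j by simp
    next
      fix i j assume ij: "(i, j) \<in> g"
      then have "i < n" "j \<noteq> i" using g(1) by auto
      then show "(i, j) \<in> fun_arcs n ?f"
        unfolding fun_arcs_def using f[OF ij] by blast
    qed
    have "?f i < n" if "i < n" for i
    proof (cases "i \<in> Domain g")
      case True
      then obtain j where "(i, j) \<in> g" by blast
      then show ?thesis using f g(1) by auto
    qed (use that in simp)
    moreover have "?f i = i" if "\<not> i < n" for i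
      using that g(1) out by blast
    ultimately have "?f \<in> F"
      by (auto simp: F_def)
    then show "?f \<in> {f \<in> F. acyclic (fun_arcs n f)}"
      using g(2) arcs by simp
  qed
  finally show ?thesis .
qed

section \<open>Convexity of the optimal weights\<close>

text \<open>\<open>opt_W\<close> is a Hilbert choice, so uniqueness is first used for existence. Any
  other W-graph is beaten by some \<open>h\<close>, which in turn is no better than the chosen
  one.\<close>

lemma opt_W_unique_min:
  assumes "unique_opt_W S A U k"
  shows "opt_W S A U k \<in> W_graphs S A k"
    and "\<And>g. g \<in> W_graphs S A k \<Longrightarrow> g \<noteq> opt_W S A U k \<Longrightarrow> W_weight U (opt_W S A U k) < W_weight U g"
proof -
  let ?P = "is_arg_min (W_weight U) (\<lambda>h. h \<in> W_graphs S A k)"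
  have ex1: "\<exists>!g. ?P g"
    using assms by (simp add: unique_opt_W_def)
  then have opt: "?P (opt_W S A U k)"
    unfolding opt_W_def arg_min_on_def arg_min_def by (meson someI_ex)
  then show "opt_W S A U k \<in> W_graphs S A k"
    by (simp add: is_arg_min_def)
  fix g assume g: "g \<in> W_graphs S A k" "g \<noteq> opt_W S A U k"
  then have "\<not> ?P g"
    using ex1 opt by blast
  with g(1) obtain h where "h \<in> W_graphs S A k" "W_weight U h < W_weight U g"
    by (auto simp: is_arg_min_def)
  then show "W_weight U (opt_W S A U k) < W_weight U g"
    using opt by (force simp: is_arg_min_def)
qed

text \<open>Exchanging between the optima with \<open>k\<close> and \<open>k + 2\<close> sinks gives
  two W-graphs with \<open>k + 1\<close> sinks and the same total weight. They differ, so at most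
  one of them is the unique optimum.\<close>

lemma opt_W_weight_strict_convex:
  assumes S: "finite S" and A: "A \<subseteq> S \<times> S"
    and uniq: "unique_opt_W S A U k" "unique_opt_W S A U (k + 1)" "unique_opt_W S A U (k + 2)"
  shows "2 * W_weight U (opt_W S A U (k + 1)) < W_weight U (opt_W S A U k) + W_weight U (opt_W S A U (k + 2))"
proof -
  let ?o = "opt_W S A U"
  note W = W_graphs_eq_forests[OF S A]
  have g: "?o k \<in> forests A" "card (?o k) + k = card S"
    and h: "?o (k + 2) \<in> forests A" "card (?o (k + 2)) + (k + 2) = card S"
    using opt_W_unique_min(1)[OF uniq(1)] opt_W_unique_min(1)[OF uniq(3)] by (simp_all add: W)
  then have "card (?o (k + 2)) < card (?o k)" by simp
  from forest_exchange[OF S A g(1) h(1) this] obtain g' h'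
    where gh: "g' \<in> forests A" "h' \<in> forests A" "card (?o k) = Suc (card g')" "card h' = Suc (card (?o (k + 2)))"
      and un: "g' \<union> h' = ?o k \<union> ?o (k + 2)" and int: "g' \<inter> h' = ?o k \<inter> ?o (k + 2)" by blast
  \<comment> \<open>If they were equal, union and intersection would agree, and the two optima would
    coincide despite their different sizes.\<close>
  have "g' \<noteq> h'"
    using un int \<open>card (?o (k + 2)) < card (?o k)\<close>
    by (metis Int_lower1 Int_lower2 Un_upper1 Un_upper2 inf.idem less_irrefl subset_antisym sup.idem)
  have mem: "g' \<in> W_graphs S A (k + 1)" "h' \<in> W_graphs S A (k + 1)"
    using gh g h by (auto simp: W)
  have le: "W_weight U (?o (k + 1)) \<le> W_weight U x"
    "x \<noteq> ?o (k + 1) \<Longrightarrow> W_weight U (?o (k + 1)) < W_weight U x" if "x \<in> W_graphs S A (k + 1)" for x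
    using opt_W_unique_min(2)[OF uniq(2) that] by force+
  have fin: "finite x" if "x \<in> forests A" for x
    using finite_forest[OF S A that] .
  have "W_weight U g' + W_weight U h' = W_weight U (?o k) + W_weight U (?o (k + 2))"
    unfolding W_weight_def using un int gh g h fin
    by (metis sum.union_inter)
  moreover have "2 * W_weight U (?o (k + 1)) < W_weight U g' + W_weight U h'"
    using \<open>g' \<noteq> h'\<close> le[OF mem(1)] le[OF mem(2)] by force
  ultimately show ?thesis by simp
qed

lemma strict_convex_slope_less:
  fixes V :: "nat \<Rightarrow> real"
  assumes conv: "\<And>k. 1 \<le> k \<Longrightarrow> k + 2 \<le> n \<Longrightarrow> 2 * V (k + 1) < V k + V (k + 2)"
    and "1 \<le> i" "i < j" "j < n"
  shows "V j - V (j + 1) < V i - V (i + 1)"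
  using assms(3,4,2)
proof (induction j rule: less_induct)
  case (less j)
  then have "0 < j" by simp
  then obtain l where l: "j = Suc l" by (blast dest: gr0_implies_Suc)
  have "V j - V (j + 1) < V l - V (l + 1)"
    using conv[of l] less.prems l by simp
  moreover have "V l - V (l + 1) \<le> V i - V (i + 1)"
    using less.IH[of l] less.prems l by (cases "i = l") auto
  ultimately show ?case by simp
qed

text \<open>Tilting \<open>V\<close> linearly until its values at \<open>k\<close> and
  \<open>k + 1\<close> agree gives a function that strictly decreases up to \<open>k\<close> and
  strictly increases from \<open>k + 1\<close>. The tilted value at \<open>m\<close> is the decay
  exponent of the best term of degree \<open>m\<close> on the scale
  \<open>exp (- \<Delta>\<^sub>k / T)\<close>.\<close>

lemma strict_convex_above_secant:
  fixes V :: "nat \<Rightarrow> real"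
  assumes conv: "\<And>k. 1 \<le> k \<Longrightarrow> k + 2 \<le> n \<Longrightarrow> 2 * V (k + 1) < V k + V (k + 2)"
    and k: "1 \<le> k" "k < n" and m: "1 \<le> m" "m \<le> n" "m \<noteq> k" "m \<noteq> k + 1"
  shows "V k + real k * (V k - V (k + 1)) < V m + real m * (V k - V (k + 1))"
proof -
  define h where "h j = V j + real j * (V k - V (k + 1))" for j
  have up: "h j < h (Suc j)" if "k < j" "j < n" for j
    using strict_convex_slope_less[of n V k j, OF conv] that k by (simp add: h_def algebra_simps)
  have down: "h (Suc j) < h j" if "1 \<le> j" "j < k" for j
    using strict_convex_slope_less[of n V j k, OF conv] that k by (simp add: h_def algebra_simps)
  have eq: "h (Suc k) = h k"
    by (simp add: h_def algebra_simps)
  have "h k < h m"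
  proof (cases "k < m")
    case True
    then have "Suc (Suc k) \<le> m" using m by simp
    then show ?thesis
      using m(2)
    proof (induction rule: dec_induct)
      case base
      show ?case using up[of "Suc k"] base eq by simp
    next
      case (step j)
      then show ?case using up[of j] by simp
    qed
  next
    case False
    then have "m < k" using m by simp
    then show ?thesis
      using m(1)
    proof (induction rule: strict_inc_induct)
      case (base j)
      then show ?case using down[of j] by simp
    next
      case (step j)
      then show ?case using down[of j] by simp
    qed
  qed
  then show ?thesis by (simp add: h_def)
qed

section \<open>Asymptotics of the roots\<close>

lemma tendsto_exp_neg_div_at_right_0:
  fixes d :: real
  assumes "0 < d"
  shows "((\<lambda>T. exp (- d / T)) \<longlongrightarrow> 0) (at_right 0)"
proof -
  have "LIM T at_right 0. - d * inverse T :> at_bot"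
    by (rule filterlim_tendsto_neg_mult_at_bot[OF tendsto_const _ filterlim_inverse_at_top_right])
       (use assms in simp)
  then show ?thesis
    by (simp add: divide_inverse filterlim_compose[OF exp_at_bot])
qed

text \<open>On the scale \<open>s = x \<mu>(T)\<close> only the summands of \<open>u\<close> and \<open>v\<close> survive in the limit, and after
  normalization their sum is \<open>(- x)\<^sup>k (1 - x)\<close>, which changes sign at \<open>x = 1\<close>.\<close>

lemma dominant_pair_root:
  fixes E b :: "'g \<Rightarrow> real" and m :: "'g \<Rightarrow> nat"
  assumes F: "finite F" "u \<in> F" "v \<in> F" and b: "\<And>g. g \<in> F \<Longrightarrow> 0 < b g"
    and m: "m v = Suc (m u)"
    and \<mu>: "\<And>T. \<mu> T = b u / b v * exp (- (E u - E v) / T)"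
    and dom: "\<And>g. g \<in> F \<Longrightarrow> g \<noteq> u \<Longrightarrow> g \<noteq> v \<Longrightarrow>
      E u + real (m u) * (E u - E v) < E g + real (m g) * (E u - E v)"
  obtains x where "(x \<longlongrightarrow> 1) (at_right 0)"
    "\<forall>\<^sub>F T in at_right 0. 1/2 \<le> x T \<and> x T \<le> 3/2 \<and>
      (\<Sum>g\<in>F. (- (x T * \<mu> T)) ^ m g * (b g * exp (- E g / T))) = 0"
proof -
  define k where "k = m u"
  define \<Delta> where "\<Delta> = E u - E v"
  define P where "P T s = (\<Sum>g\<in>F. (- s) ^ m g * (b g * exp (- E g / T)))" for T s
  define N where "N T = b u * exp (- E u / T) * \<mu> T ^ k" for T
  define r where "r g T = b g * exp (- E g / T) * \<mu> T ^ m g / N T" for g T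
  define F' where "F' = F - {u, v}"
  \<comment> \<open>Total relative size of the remaining summands, uniform in the unknown:
    \<open>2 ^ m g\<close> bounds the power for all \<open>x\<close> of modulus at most 2, which
    covers the search interval from 1/2 to 3/2.\<close>
  define e where "e T = (\<Sum>g\<in>F'. r g T * 2 ^ m g)" for T
  have b01: "0 < b u" "0 < b v"
    using b F by auto
  have mu: "0 < \<mu> T" for T
    using b01 by (simp add: \<mu>)
  have N: "0 < N T" for T
    using b01 mu by (simp add: N_def)
  have r0: "r u T = 1" for T
  proof -
    have "r u T = N T / N T"
      by (simp only: r_def N_def k_def)
    then show ?thesis
      using N[of T] by simp
  qed
  \<comment> \<open>The scale \<open>\<mu>\<close> is exactly the one on which the summands of
    \<open>u\<close> and \<open>v\<close> have equal size.\<close>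
  have r1: "r v T = 1" for T
  proof -
    have "b v * exp (- E v / T) * \<mu> T = b u * exp (- E u / T)"
      using b01 by (simp add: \<mu> diff_divide_distrib flip: exp_add)
    then have "b v * exp (- E v / T) * \<mu> T ^ m v = N T"
      unfolding m N_def k_def power_Suc mult.assoc[symmetric] by simp
    then show ?thesis
      using N[of T] by (simp add: r_def)
  qed
  have r_nonneg: "0 \<le> r g T" if "g \<in> F'" for g T
    using that b[of g] N[of T] mu[of T] by (simp add: r_def F'_def less_imp_le)
  have r_lim: "((r g) \<longlongrightarrow> 0) (at_right 0)" if g: "g \<in> F'" for g
  proof -
    define d where "d = E g + real (m g) * \<Delta> - (E u + real k * \<Delta>)"
    define C where "C = b g * (b u / b v) ^ m g / (b u * (b u / b v) ^ k)"
    have "0 < d"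
      using dom[of g] g by (simp add: d_def \<Delta>_def k_def F'_def)
    have "r g T = C * exp (- d / T)" for T
    proof -
      have pw: "\<mu> T ^ j = (b u / b v) ^ j * exp (- (real j * \<Delta>) / T)" for j
        unfolding \<mu> power_mult_distrib exp_of_nat_mult[symmetric] \<Delta>_def[symmetric] by simp
      have "r g T = (b g * (b u / b v) ^ m g * exp (- E g / T) * exp (- (real (m g) * \<Delta>) / T)) /
          (b u * (b u / b v) ^ k * (exp (- E u / T) * exp (- (real k * \<Delta>) / T)))"
        by (simp add: r_def N_def pw mult_ac)
      also have "\<dots> = C * (exp (- E g / T) * exp (- (real (m g) * \<Delta>) / T) /
          (exp (- E u / T) * exp (- (real k * \<Delta>) / T)))"
        by (simp add: C_def)
      also have "exp (- E g / T) * exp (- (real (m g) * \<Delta>) / T) /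
          (exp (- E u / T) * exp (- (real k * \<Delta>) / T)) = exp (- d / T)"
        by (simp add: d_def diff_divide_distrib add_divide_distrib flip: exp_add exp_diff)
      finally show ?thesis .
    qed
    then have "r g = (\<lambda>T. C * exp (- d / T))"
      by (rule ext)
    then show ?thesis
      using tendsto_mult_right_zero[OF tendsto_exp_neg_div_at_right_0[OF \<open>0 < d\<close>], of C] by simp
  qed
  have e_lim: "(e \<longlongrightarrow> 0) (at_right 0)"
    unfolding e_def by (rule tendsto_null_sum) (rule tendsto_mult_left_zero[OF r_lim])
  have normalized: "P T (x * \<mu> T) / N T = (- x) ^ k * (1 - x) + (\<Sum>g\<in>F'. r g T * (- x) ^ m g)" for T x
  proof -
    have "P T (x * \<mu> T) / N T = (\<Sum>g\<in>F. r g T * (- x) ^ m g)"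
      unfolding P_def sum_divide_distrib
      by (rule sum.cong) (simp_all add: r_def power_mult_distrib mult_ac flip: mult_minus_left)
    also have "\<dots> = r u T * (- x) ^ m u + (r v T * (- x) ^ m v + (\<Sum>g\<in>F'. r g T * (- x) ^ m g))"
    proof -
      have "v \<in> F - {u}" using F m by auto
      moreover have "F' = F - {u} - {v}" by (auto simp: F'_def)
      ultimately show ?thesis
        using F by (simp add: sum.remove)
    qed
    finally show ?thesis
      by (simp add: r0 r1 m k_def algebra_simps)
  qed
  have err: "\<bar>(\<Sum>g\<in>F'. r g T * (- x) ^ m g)\<bar> \<le> e T" if "\<bar>x\<bar> \<le> 2" for T x
  proof -
    have "\<bar>(\<Sum>g\<in>F'. r g T * (- x) ^ m g)\<bar> \<le> (\<Sum>g\<in>F'. \<bar>r g T * (- x) ^ m g\<bar>)"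
      by (rule sum_abs)
    also have "\<dots> \<le> e T"
      unfolding e_def
    proof (rule sum_mono)
      fix g assume "g \<in> F'"
      have "\<bar>x\<bar> ^ m g \<le> 2 ^ m g"
        using that by (intro power_mono) auto
      then show "\<bar>r g T * (- x) ^ m g\<bar> \<le> r g T * 2 ^ m g"
        using r_nonneg[OF \<open>g \<in> F'\<close>, of T] by (simp add: abs_mult power_abs mult_left_mono)
    qed
    finally show ?thesis .
  qed
  \<comment> \<open>The sign is removed so that the limit function is
    \<open>x ^ k * (1 - x)\<close>, positive to the left of 1 for every parity of
    \<open>k\<close>.\<close>
  define f where "f T x = (- 1) ^ k * (P T (x * \<mu> T) / N T)" for T x
  have f: "\<bar>f T x - x ^ k * (1 - x)\<bar> \<le> e T" if "\<bar>x\<bar> \<le> 2" for T x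
  proof -
    have "(- 1) ^ k * ((- x) ^ k) = x ^ k"
      by (simp flip: power_mult_distrib)
    then have "f T x - x ^ k * (1 - x) = (- 1) ^ k * (\<Sum>g\<in>F'. r g T * (- x) ^ m g)"
      by (simp add: f_def normalized distrib_left flip: mult.assoc)
    then show ?thesis
      using err[OF that, of T] by (simp add: abs_mult power_abs)
  qed
  have cont: "continuous_on {1/2..3/2} (f T)" for T
    unfolding f_def P_def by (intro continuous_intros) (use N[of T] in simp_all)
  define Q where "Q T x \<longleftrightarrow> 1/2 \<le> x \<and> x \<le> 3/2 \<and> P T (x * \<mu> T) = 0" for T x
  define x where "x T = (SOME x. Q T x)" for T
  \<comment> \<open>The threshold is the value of \<open>x ^ k * (1 - x)\<close> at 1/2. Its modulus
    at 3/2 is at least as large, so an error below the threshold preserves both signs.\<close>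
  have "\<forall>\<^sub>F T in at_right 0. e T < (1/2) ^ Suc k"
    using order_tendstoD(2)[OF e_lim, of "(1/2) ^ Suc k"] by simp
  then have ev: "\<forall>\<^sub>F T in at_right 0. Q T (x T)"
  proof eventually_elim
    case (elim T)
    have "0 \<le> f T (1/2)"
      using f[of "1/2" T] elim by (simp add: abs_le_iff)
    moreover have "(1/2 :: real) ^ Suc k \<le> (3/2) ^ k * (1/2)"
      by (simp add: power_mono)
    then have "f T (3/2) \<le> 0"
      using f[of "3/2" T] elim by (simp add: abs_le_iff)
    ultimately obtain y where "1/2 \<le> y" "y \<le> 3/2" "f T y = 0"
      using IVT2'[OF _ _ _ cont, of T 0] by auto
    then have "Q T y"
      using N[of T] by (simp add: Q_def f_def)
    then show ?case
      unfolding x_def by (rule someI)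
  qed
  have "((\<lambda>T. x T - 1) \<longlongrightarrow> 0) (at_right 0)"
  \<comment> \<open>The intermediate value theorem only places the root in the interval. There
    \<open>x ^ k\<close> is at least \<open>(1/2) ^ k\<close>, so dividing it out bounds the
    distance to 1 by \<open>2 ^ k\<close> times the error.\<close>
  proof (rule tendsto_0_le[OF e_lim, of _ "2 ^ k"])
    show "\<forall>\<^sub>F T in at_right 0. norm (x T - 1) \<le> norm (e T) * 2 ^ k"
      using ev
    proof eventually_elim
      case (elim T)
      then have x: "1/2 \<le> x T" "x T \<le> 3/2" "f T (x T) = 0"
        by (auto simp: Q_def f_def)
      have "x T ^ k * \<bar>1 - x T\<bar> \<le> e T"
        using f[of "x T" T] x by (simp add: abs_mult)
      moreover have "(1/2) ^ k * \<bar>1 - x T\<bar> \<le> x T ^ k * \<bar>1 - x T\<bar>"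
        using x by (intro mult_right_mono power_mono) auto
      ultimately have "(1/2) ^ k * \<bar>1 - x T\<bar> \<le> e T" by simp
      then have "\<bar>1 - x T\<bar> \<le> e T * 2 ^ k"
        by (simp add: power_one_over field_simps)
      also have "\<dots> \<le> \<bar>e T\<bar> * 2 ^ k"
        by simp
      finally show ?case
        by (simp add: abs_minus_commute)
    qed
  qed
  then have "(x \<longlongrightarrow> 1) (at_right 0)"
    by (simp add: LIM_zero_iff)
  then show thesis
    using ev that[of x] by (simp add: Q_def P_def)
qed

section \<open>Root counting and the characteristic polynomial of a generator\<close>

lemma roots_all_simple:
  fixes p :: "'a :: idom poly"
  assumes p: "p \<noteq> 0" and Z: "\<And>z. z \<in> Z \<Longrightarrow> poly p z = 0" "card Z = degree p" "finite Z"
  shows "{z. poly p z = 0} = Z" and "\<And>z. z \<in> Z \<Longrightarrow> order z p = 1"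
proof -
  have fin: "finite {z. poly p z = 0}"
    using p by (rule poly_roots_finite)
  show eq: "{z. poly p z = 0} = Z"
    using card_seteq[OF fin, of Z] card_poly_roots_bound[OF p] Z by auto
  fix z assume z: "z \<in> Z"
  have pos: "1 \<le> order y p" if "y \<in> Z" for y
    using that Z(1) p order_root[of p y] by (simp add: Suc_le_eq)
  \<comment> \<open>The orders are at least 1 each and sum to at most \<open>card Z\<close>, so none
    can exceed 1.\<close>
  have "(\<Sum>y\<in>Z. order y p) \<le> (\<Sum>y\<in>Z. 1)"
    using sum_order_le_degree[OF p] Z(2) unfolding eq by simp
  then show "order z p = 1"
    using pos z Z(3) sum_strict_mono_ex1[of Z "\<lambda>_. 1" "\<lambda>y. order y p"]
    by (metis le_neq_implies_less not_less)
qed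

text \<open>Zero row sums bring \<open>- char_matrix M t\<close> into the form required by
  \<open>matrix_forest\<close>. Forests of the complete graph that use an absent arc have weight 0
  and drop out.\<close>

lemma poly_char_poly_generator:
  assumes M: "generator_matrix n M"
  shows "poly (char_poly M) t =
    (\<Sum>g\<in>forests (arc_set n M). t ^ (n - card g) * (\<Prod>(i, j)\<in>g. M $$ (i, j)))"
proof -
  let ?A = "{(i, j). i < n \<and> j < n \<and> i \<noteq> j}"
  have c: "M \<in> carrier_mat n n" and diag: "\<And>i. i < n \<Longrightarrow> M $$ (i, i) = - (\<Sum>j\<in>{0..<n} - {i}. M $$ (i, j))"
    using M by (auto simp: generator_matrix_def)
  have "- char_matrix M t =
      mat n n (\<lambda>(i, j). if i = j then t + (\<Sum>l\<in>{0..<n} - {i}. M $$ (i, l)) else - M $$ (i, j))"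
    using c diag by (intro eq_matI) (auto simp: char_matrix_def)
  then have "poly (char_poly M) t = (\<Sum>g\<in>forests ?A. t ^ (n - card g) * (\<Prod>(i, j)\<in>g. M $$ (i, j)))"
    using char_poly_matrix[OF c, of t] matrix_forest[of n t "\<lambda>i j. M $$ (i, j)"] by simp
  also have "\<dots> = (\<Sum>g\<in>forests (arc_set n M). t ^ (n - card g) * (\<Prod>(i, j)\<in>g. M $$ (i, j)))"
  proof (rule sum.mono_neutral_right)
    have A: "?A \<subseteq> {0..<n} \<times> {0..<n}" by auto
    show "finite (forests ?A)"
      by (rule finite_forests[OF _ A]) simp
    show "forests (arc_set n M) \<subseteq> forests ?A"
      by (auto simp: forests_def arc_set_def)
    show "\<forall>g\<in>forests ?A - forests (arc_set n M). t ^ (n - card g) * (\<Prod>(i, j)\<in>g. M $$ (i, j)) = 0"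
    proof
      fix g assume g: "g \<in> forests ?A - forests (arc_set n M)"
      then obtain i j where "(i, j) \<in> g" "M $$ (i, j) = 0"
        by (auto simp: forests_def arc_set_def)
      moreover have "finite g"
        using finite_forest[OF _ A] g by blast
      ultimately have "(\<Prod>(i, j)\<in>g. M $$ (i, j)) = 0"
        by (auto intro!: prod_zero)
      then show "t ^ (n - card g) * (\<Prod>(i, j)\<in>g. M $$ (i, j)) = 0" by simp
    qed
  qed
  finally show ?thesis .
qed

section \<open>Asymptotics of the whole spectrum\<close>

theorem mainTheorem2:
  fixes n :: nat
    and L :: "real \<Rightarrow> real mat"
    and A :: "(nat \<times> nat) set"
    and a U :: "nat \<Rightarrow> nat \<Rightarrow> real"
  assumes "0 < n"
    and "\<And>T. 0 < T \<Longrightarrow> generator_matrix n (L T)"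
    and "\<And>T. 0 < T \<Longrightarrow> irreducible_generator n (L T)"
    and "\<And>T. 0 < T \<Longrightarrow> arc_set n (L T) = A"
    and "\<And>i j. (i, j) \<in> A \<Longrightarrow> 0 < a i j"
    and "\<And>i j. (i, j) \<in> A \<Longrightarrow> 0 < U i j"
    and "\<And>T i j. 0 < T \<Longrightarrow> (i, j) \<in> A \<Longrightarrow> L T $$ (i, j) = a i j * exp (- U i j / T)"
    and "\<And>k. 1 \<le> k \<Longrightarrow> k \<le> n \<Longrightarrow> unique_opt_W {0..<n} A U k"
  shows "\<exists>lam :: nat \<Rightarrow> real \<Rightarrow> real.
    (\<forall>\<^sub>F T in at_right 0.
       (\<forall>z. eigenvalue (complex_mat (L T)) z \<longrightarrow>
          z \<in> \<real> \<and> Polynomial.order z (char_poly (complex_mat (L T))) = 1) \<and>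
       (\<forall>k\<in>{1..n - 1}. 0 < lam k T) \<and>
       strict_mono_on {1..n - 1} (\<lambda>k. lam k T) \<and>
       spectrum (complex_mat (L T)) = insert 0 ((\<lambda>k. complex_of_real (- lam k T)) ` {1..n - 1})) \<and>
    (\<forall>k\<in>{1..n - 1}. \<exists>\<epsilon> \<in> o[at_right 0](\<lambda>_. 1). \<forall>\<^sub>F T in at_right 0.
       lam k T = W_prefactor {0..<n} A U a k * exp (- W_exponent {0..<n} A U k / T) * (1 + \<epsilon> T))"
proof -
  note n = assms(1) and gen = assms(2) and arcs = assms(4) and a_pos = assms(5)
    and rates = assms(7) and uniq = assms(8)
  define S where "S = {0..<n}"
  have S: "finite S" "S \<noteq> {}" "card S = n"
    using n by (auto simp: S_def)
  have A: "A \<subseteq> S \<times> S"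
    using arcs[of 1] by (auto simp: arc_set_def S_def)
  define opt where "opt k = opt_W S A U k" for k
  define V where "V k = W_weight U (opt k)" for k
  define b where "b g = (\<Prod>(i, j)\<in>g. a i j)" for g
  define \<mu> where "\<mu> k T = W_prefactor S A U a k * exp (- W_exponent S A U k / T)" for k T
  have finF: "finite (forests A)"
    by (rule finite_forests[OF S(1) A])
  have b_pos: "0 < b g" if "g \<in> forests A" for g
    unfolding b_def using that a_pos by (intro prod_pos) (auto simp: forests_def)
  have opt_forest: "opt k \<in> forests A" "card (opt k) + k = n" if "1 \<le> k" "k \<le> n" for k
    using opt_W_unique_min(1)[OF uniq[OF that]] W_graphs_eq_forests[OF S(1) A] S(3)
    by (simp_all add: opt_def S_def)
  have opt_min: "V (n - card g) < W_weight U g"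
    if "g \<in> forests A" "g \<noteq> opt (n - card g)" for g
  proof -
    have "card g < n"
      using card_forest_less[OF S(1,2) A that(1)] S(3) by simp
    then show ?thesis
      using opt_W_unique_min(2)[OF uniq[of "n - card g"], of g] that W_graphs_eq_forests[OF S(1) A] S(3)
      by (simp add: V_def opt_def S_def)
  qed
  have convex: "2 * V (k + 1) < V k + V (k + 2)" if "1 \<le> k" "k + 2 \<le> n" for k
    unfolding V_def opt_def
    by (rule opt_W_weight_strict_convex[OF S(1) A]) (use that uniq in \<open>simp_all add: S_def\<close>)
  have exponent: "W_exponent S A U k = V k - V (k + 1)" for k
    by (simp add: W_exponent_def V_def W_weight_def opt_def)
  have prefactor: "W_prefactor S A U a k = b (opt k) / b (opt (k + 1))" for k
    by (simp add: W_prefactor_def b_def opt_def)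
  have prefactor_pos: "0 < W_prefactor S A U a k" if "1 \<le> k" "k < n" for k
    using b_pos[OF opt_forest(1)] that by (simp add: prefactor)
  have \<mu>_pos: "0 < \<mu> k T" if "1 \<le> k" "k < n" for k T
    using prefactor_pos[OF that] by (simp add: \<mu>_def)
  define p where "p T t = (\<Sum>g\<in>forests A. t ^ (n - card g) * (b g * exp (- W_weight U g / T)))" for T t
  have poly_p: "poly (char_poly (L T)) t = p T t" if "0 < T" for T t
  proof -
    have "(\<Prod>(i, j)\<in>g. L T $$ (i, j)) = b g * exp (- W_weight U g / T)" if g: "g \<in> forests A" for g
    proof -
      have fin: "finite g"
        by (rule finite_forest[OF S(1) A g])
      have "(\<Prod>(i, j)\<in>g. L T $$ (i, j)) = (\<Prod>(i, j)\<in>g. a i j * exp (- U i j / T))"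
        using g rates[OF \<open>0 < T\<close>] by (intro prod.cong) (auto simp: forests_def)
      also have "\<dots> = b g * (\<Prod>(i, j)\<in>g. exp (- U i j / T))"
        by (simp add: b_def case_prod_unfold prod.distrib)
      also have "(\<Prod>(i, j)\<in>g. exp (- U i j / T)) = exp (\<Sum>(i, j)\<in>g. - U i j / T)"
        using fin by (simp add: case_prod_unfold exp_sum)
      also have "(\<Sum>(i, j)\<in>g. - U i j / T) = - W_weight U g / T"
        by (simp add: W_weight_def case_prod_unfold sum_negf sum_divide_distrib)
      finally show ?thesis .
    qed
    then show ?thesis
      using poly_char_poly_generator[OF gen[OF that], of t] arcs[OF that] by (simp add: p_def)
  qed
  \<comment> \<open>Here \<open>x\<close> is the ratio of the negated root to its predicted size
    \<open>\<mu> k\<close>.\<close>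
  define scaled_root where "scaled_root k x \<longleftrightarrow> (x \<longlongrightarrow> 1) (at_right 0) \<and>
    (\<forall>\<^sub>F T in at_right 0. 1/2 \<le> x T \<and> x T \<le> 3/2 \<and> p T (- (x T * \<mu> k T)) = 0)" for k x
  have ex_scaled_root: "\<exists>x. scaled_root k x" if k: "1 \<le> k" "k < n" for k
  proof -
    have k_card: "n - card (opt k) = k" "n - card (opt (k + 1)) = Suc k"
      using opt_forest(2)[of k] opt_forest(2)[of "k + 1"] k by auto
    \<comment> \<open>Two comparisons: \<open>g\<close> with the optimum having equally many sinks,
      then that optimum with \<open>opt k\<close> by convexity. At least one of them is
      strict.\<close>
    have dom: "V k + real k * (V k - V (k + 1)) < W_weight U g + real (n - card g) * (V k - V (k + 1))"
      if g: "g \<in> forests A" "g \<noteq> opt k" "g \<noteq> opt (k + 1)" for g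
    proof -
      define m where "m = n - card g"
      have m: "1 \<le> m" "m \<le> n"
        using card_forest_less[OF S(1,2) A g(1)] S(3) by (auto simp: m_def)
      show ?thesis
      proof (cases "g = opt m")
        case True
        then have "m \<noteq> k" "m \<noteq> k + 1" using g by blast+
        moreover have "W_weight U g = V m"
          unfolding V_def using True by (rule arg_cong)
        ultimately show ?thesis
          using strict_convex_above_secant[of n V, OF convex k m] unfolding m_def[symmetric] by simp
      next
        case False
        then have "V m < W_weight U g"
          using opt_min[OF g(1)] unfolding m_def by blast
        moreover have "V k + real k * (V k - V (k + 1)) \<le> V m + real m * (V k - V (k + 1))"
        proof (cases "m = k \<or> m = k + 1")
          case True
          then show ?thesis by (auto simp: algebra_simps)
        next
          case False
          then show ?thesis
            using strict_convex_above_secant[of n V, OF convex k m] by simp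
        qed
        ultimately show ?thesis unfolding m_def[symmetric] by simp
      qed
    qed
    have \<mu>: "\<mu> k T = b (opt k) / b (opt (k + 1)) * exp (- (W_weight U (opt k) - W_weight U (opt (k + 1))) / T)" for T
      by (simp add: \<mu>_def prefactor exponent V_def)
    obtain x where "(x \<longlongrightarrow> 1) (at_right 0)"
      "\<forall>\<^sub>F T in at_right 0. 1/2 \<le> x T \<and> x T \<le> 3/2 \<and>
        (\<Sum>g\<in>forests A. (- (x T * \<mu> k T)) ^ (n - card g) * (b g * exp (- W_weight U g / T))) = 0"
    proof (rule dominant_pair_root[where F = "forests A" and u = "opt k" and v = "opt (k + 1)"
          and b = b and E = "W_weight U" and m = "\<lambda>g. n - card g" and \<mu> = "\<mu> k"])
      show "finite (forests A)" by (rule finF)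
      show "opt k \<in> forests A" "opt (k + 1) \<in> forests A"
        using opt_forest(1) k by auto
      show "0 < b g" if "g \<in> forests A" for g
        using that by (rule b_pos)
      show "n - card (opt (k + 1)) = Suc (n - card (opt k))"
        by (simp only: k_card)
      show "\<mu> k T = b (opt k) / b (opt (k + 1)) * exp (- (W_weight U (opt k) - W_weight U (opt (k + 1))) / T)" for T
        by (rule \<mu>)
      show "W_weight U (opt k) + real (n - card (opt k)) * (W_weight U (opt k) - W_weight U (opt (k + 1)))
          < W_weight U g + real (n - card g) * (W_weight U (opt k) - W_weight U (opt (k + 1)))"
        if "g \<in> forests A" "g \<noteq> opt k" "g \<noteq> opt (k + 1)" for g
        using dom[OF that] by (simp only: k_card V_def)
    qed
    then show ?thesis
      unfolding scaled_root_def p_def by blast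
  qed
  define x where "x k = (SOME x. scaled_root k x)" for k
  have "scaled_root k (x k)" if "1 \<le> k" "k < n" for k
    unfolding x_def using ex_scaled_root[OF that] by (rule someI_ex)
  then have x_lim: "\<And>k. 1 \<le> k \<Longrightarrow> k < n \<Longrightarrow> (x k \<longlongrightarrow> 1) (at_right 0)"
    and x_root: "\<And>k. 1 \<le> k \<Longrightarrow> k < n \<Longrightarrow>
      \<forall>\<^sub>F T in at_right 0. 1/2 \<le> x k T \<and> x k T \<le> 3/2 \<and> p T (- (x k T * \<mu> k T)) = 0"
    by (simp_all add: scaled_root_def)
  define lam where "lam k T = x k T * \<mu> k T" for k T
  \<comment> \<open>The factor 3 keeps the windows from \<open>1/2 * \<mu> k T\<close> to
    \<open>3/2 * \<mu> k T\<close> disjoint for consecutive \<open>k\<close>, which orders the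
    roots. The ratio of consecutive scales tends to 0 because the exponents strictly decrease in
    \<open>k\<close>.\<close>
  have separated: "\<forall>\<^sub>F T in at_right 0. 3 * \<mu> k T < \<mu> (k + 1) T" if k: "1 \<le> k" "k + 1 < n" for k
  proof -
    define d where "d = W_exponent S A U k - W_exponent S A U (k + 1)"
    define C where "C = W_prefactor S A U a k / W_prefactor S A U a (k + 1)"
    have "0 < d"
      using convex[of k] k by (simp add: d_def exponent)
    then have "((\<lambda>T. C * exp (- d / T)) \<longlongrightarrow> 0) (at_right 0)"
      by (intro tendsto_mult_right_zero tendsto_exp_neg_div_at_right_0)
    then have "\<forall>\<^sub>F T in at_right 0. C * exp (- d / T) < 1/3"
      by (rule order_tendstoD(2)) simp
    then show ?thesis
    proof eventually_elim
      case (elim T)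
      have "\<mu> k T = C * exp (- d / T) * \<mu> (k + 1) T"
      proof -
        have "exp (- W_exponent S A U k / T) = exp (- d / T) * exp (- W_exponent S A U (k + 1) / T)"
          by (simp add: d_def diff_divide_distrib flip: exp_add)
        then show ?thesis
          using prefactor_pos[of "k + 1"] k by (simp add: \<mu>_def C_def)
      qed
      also have "\<dots> < 1/3 * \<mu> (k + 1) T"
        using elim \<mu>_pos[of "k + 1" T] k by (intro mult_strict_right_mono) auto
      finally show ?case by simp
    qed
  qed
  have main: "\<forall>\<^sub>F T in at_right 0. 0 < T \<and>
      (\<forall>k\<in>{1..n - 1}. 1/2 \<le> x k T \<and> x k T \<le> 3/2 \<and> p T (- (x k T * \<mu> k T)) = 0) \<and>
      (\<forall>k\<in>{1..<n - 1}. 3 * \<mu> k T < \<mu> (k + 1) T)"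
    by (intro eventually_conj eventually_ball_finite eventually_at_right_less ballI x_root separated) auto
  have spectral: "\<forall>\<^sub>F T in at_right 0.
       (\<forall>z. eigenvalue (complex_mat (L T)) z \<longrightarrow>
          z \<in> \<real> \<and> Polynomial.order z (char_poly (complex_mat (L T))) = 1) \<and>
       (\<forall>k\<in>{1..n - 1}. 0 < lam k T) \<and>
       strict_mono_on {1..n - 1} (\<lambda>k. lam k T) \<and>
       spectrum (complex_mat (L T)) = insert 0 ((\<lambda>k. complex_of_real (- lam k T)) ` {1..n - 1})"
    using main
  proof eventually_elim
    case (elim T)
    then have T: "0 < T" and x: "\<And>k. k \<in> {1..n - 1} \<Longrightarrow> 1/2 \<le> x k T \<and> x k T \<le> 3/2"
      and root: "\<And>k. k \<in> {1..n - 1} \<Longrightarrow> p T (- lam k T) = 0"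
      and gap: "\<And>k. k \<in> {1..<n - 1} \<Longrightarrow> 3 * \<mu> k T < \<mu> (k + 1) T"
      by (auto simp: lam_def)
    have \<mu>_pos': "0 < \<mu> k T" if "k \<in> {1..n - 1}" for k
      using \<mu>_pos[of k T] that n by auto
    have lam_bounds: "1/2 * \<mu> k T \<le> lam k T" "lam k T \<le> 3/2 * \<mu> k T" if "k \<in> {1..n - 1}" for k
      unfolding lam_def using x[OF that] \<mu>_pos'[OF that] by (auto intro!: mult_right_mono)
    have lam_pos: "0 < lam k T" if "k \<in> {1..n - 1}" for k
      using lam_bounds(1)[OF that] \<mu>_pos'[OF that] by simp
    have lam_step: "lam k T < lam (Suc k) T" if "1 \<le> k" "k < n - 1" for k
      using lam_bounds(2)[of k] lam_bounds(1)[of "Suc k"] gap[of k] that by force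
    have mono: "strict_mono_on {1..n - 1} (\<lambda>k. lam k T)"
    proof (rule strict_mono_onI)
      fix i j assume ij: "i \<in> {1..n - 1}" "j \<in> {1..n - 1}" "i < j"
      have "Suc i \<le> j" "j \<le> n - 1" using ij by auto
      then show "lam i T < lam j T"
      proof (induction rule: dec_induct)
        case base
        then show ?case using lam_step[of i] ij by simp
      next
        case (step l)
        then show ?case using lam_step[of l] ij by simp
      qed
    qed
    define q where "q = char_poly (complex_mat (L T))"
    define Z where "Z = insert 0 ((\<lambda>k. complex_of_real (- lam k T)) ` {1..n - 1})"
    have LT: "L T \<in> carrier_mat n n"
      using gen[OF T] by (simp add: generator_matrix_def)
    then have cLT: "complex_mat (L T) \<in> carrier_mat n n"
      by simp
    have deg: "degree q = n" "q \<noteq> 0"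
      using degree_monic_char_poly[OF cLT] by (auto simp: q_def)
    have "q = map_poly complex_of_real (char_poly (L T))"
      unfolding q_def by (rule of_real_hom.char_poly_hom[OF LT])
    then have q_root: "poly q (complex_of_real t) = 0" if "p T t = 0" for t
      using that poly_p[OF T, of t] by (simp add: of_real_hom.poly_map_poly)
    \<comment> \<open>Every forest has a sink, so each summand of \<open>p T t\<close> contains a
      factor \<open>t\<close>, and 0 is a root.\<close>
    have "card g < n" if "g \<in> forests A" for g
      using card_forest_less[OF S(1,2) A that] S(3) by simp
    then have "p T 0 = 0"
      unfolding p_def by (intro sum.neutral ballI) simp
    then have Z_root: "poly q z = 0" if "z \<in> Z" for z
      using that q_root[of 0] q_root[OF root] by (auto simp: Z_def)
    have "inj_on (\<lambda>k. complex_of_real (- lam k T)) {1..n - 1}"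
      using strict_mono_on_imp_inj_on[OF mono] by (simp add: inj_on_def)
    moreover have "0 \<notin> (\<lambda>k. complex_of_real (- lam k T)) ` {1..n - 1}"
      using lam_pos by fastforce
    ultimately have "card Z = degree q" "finite Z"
      using n by (simp_all add: Z_def card_image deg)
    \<comment> \<open>The \<open>n\<close> distinct real roots match the degree over the complex
      numbers, which rules out nonreal and multiple eigenvalues.\<close>
    note simple = roots_all_simple[OF deg(2) Z_root this]
    have ev: "eigenvalue (complex_mat (L T)) z \<longleftrightarrow> z \<in> Z" for z
      using simple(1) by (auto simp: eigenvalue_root_char_poly[OF cLT] q_def[symmetric])
    have "Z \<subseteq> \<real>"
      by (auto simp: Z_def)
    moreover have "spectrum (complex_mat (L T)) = Z"
      using ev by (auto simp: spectrum_def)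
    ultimately show ?case
      unfolding q_def[symmetric] Z_def[symmetric] using ev simple(2) lam_pos mono by blast
  qed
  have "\<exists>\<epsilon> \<in> o[at_right 0](\<lambda>_. 1). \<forall>\<^sub>F T in at_right 0.
      lam k T = W_prefactor S A U a k * exp (- W_exponent S A U k / T) * (1 + \<epsilon> T)"
    if k: "k \<in> {1..n - 1}" for k
  proof
    \<comment> \<open>By definition \<open>lam k T\<close> is \<open>x k T\<close> times the
      prediction, so the relative error is exactly \<open>x k T - 1\<close>.\<close>
    have "((\<lambda>T. x k T - 1) \<longlongrightarrow> 0) (at_right 0)"
      using x_lim[of k] k n by (auto simp: LIM_zero_iff)
    then show "(\<lambda>T. x k T - 1) \<in> o[at_right 0](\<lambda>_. 1)"
      by (intro smalloI_tendsto) auto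
    show "\<forall>\<^sub>F T in at_right 0.
      lam k T = W_prefactor S A U a k * exp (- W_exponent S A U k / T) * (1 + (x k T - 1))"
      by (simp add: lam_def \<mu>_def)
  qed
  with spectral show ?thesis
    unfolding S_def by blast
qed

end
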